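(* For all positive integers $n$ and all positive integers $k\le n$ we have $$A(n,k-1)\cdot A(n,k+1)\le A(n,k)^2,$$ and also, when $n$ is even, $$U(n,k-1)\cdot U(n,k+1)\le U(n,k)^2.$$
   Context: An $n$-permutation is a permutation $p=p_1p_2\cdots p_n$ of $\{1,\ldots,n\}$ in one-line notation. An index $i$ with $1\le i\le n-1$ is a descent of $p$ if $p_i>p_{i+1}$. $A(n,k)$ is the number of $n$-permutations with exactly $k$ descents. For even $n$, a half-ascending permutation is an $n$-permutation $p$ with $p_{2i-1}<p_{2i}$ for all $1\le i\le n/2$, and $U(n,k)$ is the number of half-ascending $n$-permutations with exactly $k$ descents. *)

theory Defs
  imports "HOL-Combinatorics.Permutations"
begin

text \<open>
  An \<open>n\<close>-permutation \<open>p\<^sub>1 \<dots> p\<^sub>n\<close> is a function with \<open>p permutes {1..n}\<close>, whose \<open>i\<close>-th entry is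
  \<open>p i\<close>. Such a function is the identity outside \<open>{1..n}\<close>, so distinct functions are distinct
  \<open>n\<close>-permutations.
\<close>

definition descents :: "nat \<Rightarrow> (nat \<Rightarrow> nat) \<Rightarrow> nat set" where
  "descents n p = {i. 1 \<le> i \<and> i \<le> n - 1 \<and> p i > p (i + 1)}"

definition A :: "nat \<Rightarrow> nat \<Rightarrow> nat" where
  "A n k = card {p. p permutes {1..n} \<and> card (descents n p) = k}"

text \<open>The next two notions are meaningful only for even \<open>n\<close>.\<close>

definition half_ascending :: "nat \<Rightarrow> (nat \<Rightarrow> nat) \<Rightarrow> bool" where
  "half_ascending n p \<longleftrightarrow> p permutes {1..n} \<and> (\<forall>i. 1 \<le> i \<and> i \<le> n div 2 \<longrightarrow> p (2 * i - 1) < p (2 * i))"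

definition U :: "nat \<Rightarrow> nat \<Rightarrow> nat" where
  "U n k = card {p. half_ascending n p \<and> card (descents n p) = k}"

end

theory Submission
  imports Defs "HOL-Combinatorics.Multiset_Permutations"
    "HOL-Computational_Algebra.Formal_Power_Series"
begin

text \<open>
  Both families of numbers count permutations by descents whose one-line notation, cut into \<open>m\<close>
  consecutive blocks of length \<open>b\<close>, ascends inside each block: \<open>b = 1\<close> gives \<open>A\<close> and \<open>b = 2\<close> gives \<open>U\<close>.
  The idea is to find recurrences with nonnegative coefficients for these numbers, and to show that
  the recurrences preserve log-concavity.
  
  The recurrences come from a version of Worpitzky's identity (\<open>worpitzky\<close>). Sorting the elements of a
  set of size \<open>b m\<close> by their value under a map to \<open>r\<close> values, all of whose fibres have size divisible
  by \<open>b\<close>, yields such a permutation together with a labelling of its blocks, and a permutation with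
  \<open>d\<close> descents arises from \<open>(m + r - 1 - d) choose m\<close> labellings. On the other hand, the number of
  these maps is \<open>(b m)!\<close> times the coefficient of \<open>z ^ (b m)\<close> in \<open>exp z ^ r\<close> for \<open>b = 1\<close>, and
  in \<open>cosh z ^ r\<close> for \<open>b = 2\<close>. Hence the polynomial \<open>P\<close> of the descent numbers is \<open>(1 - X) ^ (m + 1)\<close>
  times the generating function over \<open>r\<close> of these coefficients (\<open>descent_fps_eq\<close>).
  
  For \<open>b = 1\<close>, differentiating \<open>exp\<close> gives the well-known recurrence
  \<open>A (n + 1) k = (k + 1) * A n k + (n + 1 - k) * A n (k - 1)\<close>. For \<open>b = 2\<close>, the identity
  \<open>sinh\<^sup>2 = cosh\<^sup>2 - 1\<close> gives a recurrence that factors into two steps through auxiliary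
  numbers \<open>T k\<close> for \<open>2 * m + 1\<close> elements:
  \<open>T k = (k + 1) * U (2 * m) k + (m + 1) * U (2 * m) (k - 1) + (m + 1 - k) * U (2 * m) (k - 2)\<close> and
  \<open>U (2 * m + 2) k = (k + 1) * T k + (m + 1 - k) * T (k - 1)\<close>.
  
  Both kinds of step preserve log-concavity (\<open>log_concave_on_two_term\<close>,
  \<open>log_concave_on_three_term\<close>): after expanding the products and using log-concavity of the old
  sequence term by term, what remains is a sum of manifestly nonnegative expressions.
\<close>

unbundle fps_syntax

section \<open>Descents of lists that are cut into ascending blocks\<close>

fun des :: "nat list \<Rightarrow> nat" where
  "des [] = 0"
| "des [x] = 0"
| "des (x # y # xs) = (if x > y then 1 else 0) + des (y # xs)"

lemma des_append:
  "xs \<noteq> [] \<Longrightarrow> ys \<noteq> [] \<Longrightarrow>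
    des (xs @ ys) = des xs + (if last xs > hd ys then 1 else 0) + des ys"
proof (induction xs rule: des.induct)
  case (2 x)
  then show ?case by (cases ys) auto
qed auto

lemma des_eq_0_iff_sorted: "des xs = 0 \<longleftrightarrow> sorted xs"
  by (induction xs rule: des.induct) (auto simp: not_less intro: order_trans)

lemma le_last_if_sorted: "sorted xs \<Longrightarrow> x \<in> set xs \<Longrightarrow> x \<le> last xs"
  by (induction xs) auto

text \<open>
  Half-ascending permutations are those whose entries ascend inside consecutive blocks of length
  \<open>2\<close>; for blocks of length \<open>1\<close> the condition is void. List positions start at \<open>0\<close>, so the pair
  \<open>i, Suc i\<close> lies inside one block exactly if \<open>b\<close> does not divide \<open>Suc i\<close>. Divisibility of the length
  is included so that the last block is complete.
\<close>

definition blockwise :: "nat \<Rightarrow> nat list \<Rightarrow> bool" where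
  "blockwise b xs \<longleftrightarrow> b dvd length xs \<and>
    (\<forall>i. Suc i < length xs \<longrightarrow> \<not> b dvd Suc i \<longrightarrow> xs ! i \<le> xs ! Suc i)"

lemma blockwise_take:
  assumes "blockwise b xs" shows "blockwise b (take (b * i) xs)"
  using assms by (auto simp: blockwise_def min_def)

lemma blockwise_append_sorted:
  assumes "blockwise b xs" "sorted ys" "b dvd length ys"
  shows "blockwise b (xs @ ys)"
  unfolding blockwise_def
proof (intro conjI allI impI)
  show "b dvd length (xs @ ys)"
    using assms by (auto simp: blockwise_def)
next
  fix i assume i: "Suc i < length (xs @ ys)" "\<not> b dvd Suc i"
  have "Suc i \<noteq> length xs"
    using assms(1) i(2) by (auto simp: blockwise_def)
  then consider "Suc i < length xs" | "i \<ge> length xs" by linarith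
  then show "(xs @ ys) ! i \<le> (xs @ ys) ! Suc i"
  proof cases
    case 1
    then show ?thesis
      using assms(1) i(2) by (auto simp: blockwise_def nth_append)
  next
    case 2
    then have "Suc i - length xs = Suc (i - length xs)" by simp
    then show ?thesis
      using 2 i(1) assms(2) by (auto simp: nth_append sorted_iff_nth_Suc)
  qed
qed

lemma blockwise_last_block_sorted:
  assumes "blockwise b xs" "length xs = b * Suc m" "b > 0"
  shows "sorted (drop (b * m) xs)"
  unfolding sorted_iff_nth_Suc
proof (intro allI impI)
  fix i assume i: "Suc i < length (drop (b * m) xs)"
  then have "Suc i < b" using assms by (simp add: algebra_simps)
  then have "\<not> b dvd Suc i" by (auto dest: dvd_imp_le)
  then have "\<not> b dvd Suc (b * m + i)"
    by (metis add_Suc_right dvd_add_right_iff dvd_triv_left)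
  then show "drop (b * m) xs ! i \<le> drop (b * m) xs ! Suc i"
    using assms(1) i by (auto simp: blockwise_def)
qed

text \<open>
  Descents can occur only at the \<open>m\<close> boundaries between the \<open>m + 1\<close> blocks.
\<close>

lemma des_less_blocks:
  assumes "blockwise b xs" "length xs = b * Suc m" "b > 0"
  shows "des xs \<le> m"
  using assms(1,2)
proof (induction m arbitrary: xs)
  case 0
  then have "sorted xs" using blockwise_last_block_sorted[of b xs 0] assms(3) by simp
  then show ?case by (simp flip: des_eq_0_iff_sorted)
next
  case (Suc m)
  let ?ys = "take (b * Suc m) xs" and ?zs = "drop (b * Suc m) xs"
  have ne: "?ys \<noteq> []" "?zs \<noteq> []"
    using Suc.prems(2) assms(3) by auto
  have "des ?ys \<le> m"
    using Suc.IH[OF blockwise_take[OF Suc.prems(1)], of "Suc m"] Suc.prems(2) by simp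
  moreover have "des ?zs = 0"
    using blockwise_last_block_sorted Suc.prems assms(3) des_eq_0_iff_sorted by blast
  ultimately show ?case
    using des_append[OF ne] by (simp split: if_splits)
qed

text \<open>
  This is the inductive step of Worpitzky's identity for a single list. Think of
  \<open>(m + r - 1 - des xs) choose m\<close> as the number of ways to label the \<open>m\<close> blocks of \<open>xs\<close> with weakly
  increasing labels from an \<open>r\<close>-element set such that the label strictly increases at each descent.
  With one more label available, the blocks that carry the largest label form a sorted suffix, and the
  blocks before it are labelled with the other \<open>r\<close> labels. In the proof, the induction on \<open>m\<close> turns
  this into Pascal's rule: the summand for the empty suffix is one term of the rule, and all others
  together are the other term. If a descent precedes the last block, then only one nonempty suffix
  is sorted; otherwise the nonempty sorted suffixes correspond to all sorted suffixes of the list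
  without its last block.
\<close>

lemma sum_sorted_suffixes:
  assumes "blockwise b xs" "length xs = b * m" "b > 0"
  shows "(\<Sum>i | i \<le> m \<and> sorted (drop (b * i) xs).
            (i + r - 1 - des (take (b * i) xs)) choose i) = (m + r - des xs) choose m"
  using assms(1,2)
proof (induction m arbitrary: xs)
  case 0
  have "{i. i \<le> 0 \<and> sorted (drop (b * i) xs)} = {0}" using 0 by auto
  then show ?case using 0 by simp
next
  case (Suc m)
  let ?ys = "take (b * m) xs" and ?zs = "drop (b * m) xs"
  let ?t = "\<lambda>xs i. (i + r - 1 - des (take (b * i) xs)) choose i"
  let ?I = "\<lambda>xs k. {i. i \<le> k \<and> sorted (drop (b * i) xs)}"
  have ys: "blockwise b ?ys" "length ?ys = b * m"
    using Suc.prems blockwise_take by auto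
  have zs: "sorted ?zs" "?zs \<noteq> []"
    using blockwise_last_block_sorted Suc.prems assms(3) by auto
  have des_le: "des xs \<le> m" using des_less_blocks Suc.prems assms(3) by blast
  have top: "?I xs (Suc m) = insert (Suc m) (?I xs m)"
    using Suc.prems by (auto simp: le_Suc_eq)
  have "(\<Sum>i\<in>?I xs (Suc m). ?t xs i) = ?t xs (Suc m) + (\<Sum>i\<in>?I xs m. ?t xs i)"
    unfolding top by (subst sum.insert) auto
  also have "?t xs (Suc m) = (m + r - des xs) choose Suc m"
    using Suc.prems by simp
  also have "(\<Sum>i\<in>?I xs m. ?t xs i) = (m + r - des xs) choose m"
  proof (cases "?ys \<noteq> [] \<and> last ?ys > hd ?zs")
    case True
    have des: "des xs = Suc (des ?ys)"
      using des_append[of ?ys ?zs] True zs des_eq_0_iff_sorted[of ?zs] by simp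
    \<comment> \<open>A longer suffix contains the descent in front of the last block.\<close>
    have "\<not> sorted (drop (b * i) xs)" if "i < m" for i
    proof
      assume "sorted (drop (b * i) xs)"
      moreover have "drop (b * i) xs = drop (b * i) ?ys @ ?zs"
        using that by (metis append_take_drop_id drop_append drop_0 diff_is_0_eq length_take
            mult_le_mono2 less_imp_le ys(2))
      ultimately have "sorted (drop (b * i) ?ys @ ?zs)" by simp
      moreover have "last ?ys \<in> set (drop (b * i) ?ys)"
      proof -
        have "b * i < length ?ys" using ys(2) that assms(3) by simp
        then show ?thesis by (metis last_drop last_in_set drop_eq_Nil not_le)
      qed
      moreover have "hd ?zs \<in> set ?zs" using zs(2) by simp
      ultimately have "last ?ys \<le> hd ?zs" unfolding sorted_append by blast
      then show False using True by simp
    qed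
    then have "?I xs m = {m}" using zs(1) by (auto simp: le_less)
    then show ?thesis using des by simp
  next
    case False
    have des: "des xs = des ?ys"
      using des_append[of ?ys ?zs] False zs des_eq_0_iff_sorted[of ?zs] by (cases "?ys = []") auto
    \<comment> \<open>There is no descent in front of the last block, so attaching it keeps a suffix sorted.\<close>
    have "sorted (drop (b * i) xs) \<longleftrightarrow> sorted (drop (b * i) ?ys)" if "i \<le> m" for i
    proof -
      have split: "drop (b * i) xs = drop (b * i) ?ys @ ?zs"
        using that by (metis append_take_drop_id drop_append drop_0 diff_is_0_eq
            mult_le_mono2 ys(2))
      have "\<forall>x\<in>set (drop (b * i) ?ys). \<forall>y\<in>set ?zs. x \<le> y" if s: "sorted (drop (b * i) ?ys)"
      proof (intro ballI)
        fix x y assume x: "x \<in> set (drop (b * i) ?ys)" and y: "y \<in> set ?zs"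
        have ne: "drop (b * i) ?ys \<noteq> []" using x by force
        have "x \<le> last (drop (b * i) ?ys)" 
          by (rule le_last_if_sorted[OF s x])
        also have "\<dots> = last ?ys" using ne by (metis last_drop drop_eq_Nil not_le)
        also have "\<dots> \<le> hd ?zs" using False ne by force
        also have "\<dots> \<le> y" using zs y by (cases ?zs) auto
        finally show "x \<le> y" .
      qed
      then show ?thesis unfolding split sorted_append using zs(1) by blast
    qed
    then have "?I xs m = ?I ?ys m" by auto
    moreover have "?t xs i = ?t ?ys i" if "i \<in> ?I ?ys m" for i
      using that by (simp add: min_absorb1)
    ultimately have "(\<Sum>i\<in>?I xs m. ?t xs i) = (\<Sum>i\<in>?I ?ys m. ?t ?ys i)"
      by (metis (no_types, lifting) sum.cong)
    also have "\<dots> = (m + r - des ?ys) choose m"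
      using Suc.IH[OF ys] .
    finally show ?thesis using des by simp
  qed
  finally show ?case using des_le by (simp add: Suc_diff_le)
qed

section \<open>Worpitzky's identity for blocks\<close>

lemma sum_Pow_by_card:
  fixes f :: "nat \<Rightarrow> real"
  assumes "finite X"
  shows "(\<Sum>Y\<in>Pow X. f (card Y)) = (\<Sum>i\<le>card X. real (card X choose i) * f i)"
proof -
  have "(\<Sum>Y\<in>Pow X. f (card Y)) = (\<Sum>i\<le>card X. \<Sum>Y | Y \<in> Pow X \<and> card Y = i. f (card Y))"
    by (rule sum.group[symmetric]) (use assms card_mono in auto)
  also have "\<dots> = (\<Sum>i\<le>card X. real (card X choose i) * f i)"
    by (rule sum.cong) (simp_all add: n_subsets[OF assms])
  finally show ?thesis .
qed

definition block_perms :: "nat \<Rightarrow> nat set \<Rightarrow> nat list set" where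
  "block_perms b X = {xs \<in> permutations_of_set X. blockwise b xs}"

lemma finite_block_perms [simp]: "finite (block_perms b X)"
  by (simp add: block_perms_def)

lemma block_permsD:
  assumes "xs \<in> block_perms b X"
  shows "distinct xs" "set xs = X" "blockwise b xs" "length xs = card X" "b dvd card X"
  using assms by (auto simp: block_perms_def permutations_of_set_def blockwise_def distinct_card)

text \<open>
  Cutting a list into a prefix and a sorted suffix, both made of whole blocks, is the same as choosing
  the set \<open>Y\<close> of entries of the suffix and an arrangement of the remaining elements: the suffix is
  recovered by sorting \<open>Y\<close>.
\<close>

lemma sum_block_perms_last_class:
  fixes f :: "nat list \<Rightarrow> real"
  assumes "finite X" "card X = b * m" "b > 0"
  shows "(\<Sum>Y | Y \<subseteq> X \<and> b dvd card Y. \<Sum>xs\<in>block_perms b (X - Y). f xs) =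
         (\<Sum>xs\<in>block_perms b X. \<Sum>i | i \<le> m \<and> sorted (drop (b * i) xs). f (take (b * i) xs))"
proof -
  have fin: "finite {Y. Y \<subseteq> X \<and> b dvd card Y}"
    using assms(1) by (auto intro: finite_subset[of _ "Pow X"])
  have "(\<Sum>Y | Y \<subseteq> X \<and> b dvd card Y. \<Sum>xs\<in>block_perms b (X - Y). f xs) =
        (\<Sum>(Y, xs)\<in>(SIGMA Y:{Y. Y \<subseteq> X \<and> b dvd card Y}. block_perms b (X - Y)). f xs)"
    using fin by (subst sum.Sigma) auto
  also have "\<dots> = (\<Sum>(xs, i)\<in>(SIGMA xs:block_perms b X. {i. i \<le> m \<and> sorted (drop (b * i) xs)}).
                    f (take (b * i) xs))"
  proof (rule sum.reindex_bij_witness[where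
        i = "\<lambda>(xs, i). (set (drop (b * i) xs), take (b * i) xs)" and
        j = "\<lambda>(Y, xs). (xs @ sorted_list_of_set Y, length xs div b)"], goal_cases)
    case (1 a)
    then obtain Y xs where a: "a = (Y, xs)" "Y \<subseteq> X" "b dvd card Y" "xs \<in> block_perms b (X - Y)"
      by auto
    then show ?case
      using assms block_permsD[OF a(4)] finite_subset[OF a(2)] by (auto simp: blockwise_def)
  next
    case (2 a)
    then obtain Y xs where a: "a = (Y, xs)" "Y \<subseteq> X" "b dvd card Y" "xs \<in> block_perms b (X - Y)"
      by auto
    note xs = block_permsD[OF a(4)]
    have fY: "finite Y" using a(2) assms(1) finite_subset by blast
    have "xs @ sorted_list_of_set Y \<in> block_perms b X"
      using a(2,3) fY xs by (auto simp: block_perms_def permutations_of_set_def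
          intro!: blockwise_append_sorted)
    moreover have "length xs div b \<le> m"
      using xs(4) assms by (metis a(2) card_mono Diff_subset div_le_mono nonzero_mult_div_cancel_left less_not_refl)
    moreover have "b * (length xs div b) = length xs" using xs(4,5) by simp
    ultimately show ?case using a(1) by simp
  next
    case (3 a)
    then obtain xs i where a: "a = (xs, i)" "xs \<in> block_perms b X" "i \<le> m" "sorted (drop (b * i) xs)"
      by auto
    note xs = block_permsD[OF a(2)]
    have "sorted_list_of_set (set (drop (b * i) xs)) = drop (b * i) xs"
      using a(4) xs(1) by (simp add: sorted_list_of_set.idem_if_sorted_distinct)
    then show ?case using a xs assms by (auto simp: min_def)
  next
    case (4 a)
    then obtain xs i where a: "a = (xs, i)" "xs \<in> block_perms b X" "i \<le> m" "sorted (drop (b * i) xs)"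
      by auto
    note xs = block_permsD[OF a(2)]
    have "card (set (drop (b * i) xs)) = b * (m - i)"
      using xs assms by (simp add: distinct_card right_diff_distrib')
    moreover have "set (drop (b * i) xs) \<subseteq> X" using xs(2) set_drop_subset by fast
    moreover have "X - set (drop (b * i) xs) = set (take (b * i) xs)"
      using xs(1,2) by (metis Diff_cancel Un_Diff Un_Diff_Int append_take_drop_id distinct_append
          set_append Diff_triv Un_empty_right)
    ultimately show ?case using a(1) xs
      by (auto simp: block_perms_def permutations_of_set_def intro: blockwise_take)
  next
    case (5 a)
    then obtain Y xs where a: "a = (Y, xs)" "xs \<in> block_perms b (X - Y)"
      by auto
    then show ?case using block_permsD[OF a(2)] by simp
  qed
  also have "\<dots> = (\<Sum>xs\<in>block_perms b X. \<Sum>i | i \<le> m \<and> sorted (drop (b * i) xs). f (take (b * i) xs))"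
    by (subst sum.Sigma) auto
  finally show ?thesis .
qed

text \<open>
  The exponential generating function for the finite sets of size divisible by \<open>b\<close>; it is \<open>exp\<close> for
  \<open>b = 1\<close> and \<open>cosh\<close> for \<open>b = 2\<close>.
\<close>

definition class_egf :: "nat \<Rightarrow> real fps" where
  "class_egf b = Abs_fps (\<lambda>n. if b dvd n then 1 / fact n else 0)"

text \<open>
  This is the number of maps from a set of size \<open>b * m\<close> to a set of size \<open>r\<close> all of whose fibres have
  size divisible by \<open>b\<close>.
\<close>

definition block_maps :: "nat \<Rightarrow> nat \<Rightarrow> nat \<Rightarrow> real" where
  "block_maps b m r = fact (b * m) * (class_egf b ^ r) $ (b * m)"

text \<open>
  Sorting the elements of \<open>X\<close> by their value under a map with fibres of size divisible by \<open>b\<close>, and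
  increasingly within each fibre, gives a list that ascends inside each block, labelled by the values of the
  map; this explains why both sides count the same maps. The formal proof is an induction on the number
  \<open>r\<close> of values that splits off the fibre \<open>Y\<close> of the last value. On the left this is
  the identity on sorted suffixes, on the right it is the product rule for exponential generating
  functions.
\<close>

lemma worpitzky:
  assumes "finite X" "card X = b * m" "b > 0"
  shows "(\<Sum>xs\<in>block_perms b X. real ((m + r - 1 - des xs) choose m)) = block_maps b m r"
  using assms(1,2)
proof (induction r arbitrary: X m)
  case 0
  show ?case
  proof (cases m)
    case 0
    then have "X = {}" using 0 \<open>finite X\<close> \<open>card X = b * m\<close> by simp
    then have "block_perms b X = {[]}" by (auto simp: block_perms_def blockwise_def)
    then show ?thesis using \<open>m = 0\<close> by (simp add: block_maps_def)
  next
    case (Suc m')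
    then show ?thesis using assms(3) by (simp add: block_maps_def binomial_eq_0)
  qed
next
  case (Suc r)
  let ?n = "b * m"
  let ?f = "\<lambda>xs. real ((length xs div b + r - 1 - des xs) choose (length xs div b))"
  have "(\<Sum>xs\<in>block_perms b X. real ((m + Suc r - 1 - des xs) choose m)) =
        (\<Sum>xs\<in>block_perms b X. \<Sum>i | i \<le> m \<and> sorted (drop (b * i) xs). ?f (take (b * i) xs))"
  proof (rule sum.cong)
    fix xs assume "xs \<in> block_perms b X"
    note xs = block_permsD[OF this]
    have "(\<Sum>i | i \<le> m \<and> sorted (drop (b * i) xs). ?f (take (b * i) xs)) =
          real (\<Sum>i | i \<le> m \<and> sorted (drop (b * i) xs).
                 (i + r - 1 - des (take (b * i) xs)) choose i)"
      unfolding of_nat_sum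
      by (rule sum.cong) (use xs assms(3) Suc.prems in \<open>auto simp: min_def\<close>)
    also have "\<dots> = real ((m + r - des xs) choose m)"
      using sum_sorted_suffixes[OF xs(3)] xs(4) Suc.prems(2) assms(3) by simp
    finally show "real ((m + Suc r - 1 - des xs) choose m) =
      (\<Sum>i | i \<le> m \<and> sorted (drop (b * i) xs). ?f (take (b * i) xs))" by simp
  qed simp
  also have "\<dots> = (\<Sum>Y | Y \<subseteq> X \<and> b dvd card Y. \<Sum>xs\<in>block_perms b (X - Y). ?f xs)"
    using sum_block_perms_last_class[OF Suc.prems assms(3)] by simp
  also have "\<dots> = (\<Sum>Y | Y \<subseteq> X \<and> b dvd card Y. fact (?n - card Y) * (class_egf b ^ r) $ (?n - card Y))"
  proof (rule sum.cong)
    fix Y assume "Y \<in> {Y. Y \<subseteq> X \<and> b dvd card Y}"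
    then obtain j where Y: "Y \<subseteq> X" "card Y = b * j" by (auto elim: dvdE)
    have cd: "card (X - Y) = b * (m - j)"
      using Y Suc.prems by (simp add: card_Diff_subset finite_subset right_diff_distrib')
    have "(\<Sum>xs\<in>block_perms b (X - Y). ?f xs) =
          (\<Sum>xs\<in>block_perms b (X - Y). real ((m - j + r - 1 - des xs) choose (m - j)))"
      by (rule sum.cong) (use assms(3) cd in \<open>auto dest!: block_permsD(4)\<close>)
    also have "\<dots> = block_maps b (m - j) r"
      using Suc.IH cd Suc.prems(1) by blast
    finally show "(\<Sum>xs\<in>block_perms b (X - Y). ?f xs) =
        fact (?n - card Y) * (class_egf b ^ r) $ (?n - card Y)"
      using Y by (simp add: block_maps_def right_diff_distrib')
  qed simp
  also have "\<dots> = (\<Sum>Y\<in>Pow X. (if b dvd card Y then fact (?n - card Y) * (class_egf b ^ r) $ (?n - card Y) else 0))"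
    by (subst sum.inter_filter[symmetric]) (use Suc.prems in \<open>auto intro: sum.cong\<close>)
  also have "\<dots> = (\<Sum>i\<le>?n. real (?n choose i) *
      (if b dvd i then fact (?n - i) * (class_egf b ^ r) $ (?n - i) else 0))"
    using sum_Pow_by_card[OF Suc.prems(1)] Suc.prems(2) by simp
  also have "\<dots> = (\<Sum>i\<le>?n. fact ?n * (class_egf b $ i * (class_egf b ^ r) $ (?n - i)))"
    by (rule sum.cong) (auto simp: class_egf_def binomial_fact field_simps)
  also have "\<dots> = block_maps b m (Suc r)"
    by (simp add: block_maps_def fps_mult_nth sum_distrib_left atLeast0AtMost)
  finally show ?case .
qed

section \<open>Generating functions of the descent numbers\<close>

lemma one_minus_X_power_times_binomial_series:
  "(1 - fps_X) ^ Suc m * Abs_fps (\<lambda>j. real ((m + j) choose m)) = 1"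
proof (induction m)
  case 0
  show ?case by (rule fps_ext) (auto simp: left_diff_distrib)
next
  case (Suc m)
  have "(1 - fps_X) * Abs_fps (\<lambda>j. real ((Suc m + j) choose Suc m)) =
        Abs_fps (\<lambda>j. real ((m + j) choose m))"
  proof (rule fps_ext)
    fix j show "((1 - fps_X) * Abs_fps (\<lambda>j. real ((Suc m + j) choose Suc m))) $ j =
        Abs_fps (\<lambda>j. real ((m + j) choose m)) $ j"
      by (cases j) (simp_all add: left_diff_distrib)
  qed
  then show ?case using Suc by (simp add: power_Suc2 mult.assoc del: power_Suc)
qed

definition descent_count :: "nat \<Rightarrow> nat \<Rightarrow> nat \<Rightarrow> nat" where
  "descent_count b m k = card {xs \<in> block_perms b {1..b * m}. des xs = k}"

definition descent_fps :: "nat \<Rightarrow> nat \<Rightarrow> real fps" where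
  "descent_fps b m = Abs_fps (\<lambda>k. real (descent_count b m k))"

definition block_maps_fps :: "nat \<Rightarrow> nat \<Rightarrow> real fps" where
  "block_maps_fps b m = Abs_fps (\<lambda>r. block_maps b m (Suc r))"

text \<open>
  Multiplying by \<open>(1 - X) ^ Suc m\<close> inverts the binomial sums of Worpitzky's identity, so the descent
  numbers inherit every recurrence that the numbers \<open>block_maps b m r\<close> satisfy.
\<close>

lemma descent_fps_eq:
  assumes "b > 0"
  shows "descent_fps b m = (1 - fps_X) ^ Suc m * block_maps_fps b m"
proof -
  let ?P = "block_perms b {1..b * m}"
  let ?B = "Abs_fps (\<lambda>j. real ((m + j) choose m))"
  have "block_maps_fps b m = descent_fps b m * ?B"
  proof (rule fps_ext)
    fix r
    have "block_maps_fps b m $ r = (\<Sum>xs\<in>?P. real ((m + r - des xs) choose m))"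
      using worpitzky[of "{1..b * m}" b m "Suc r"] assms by (simp add: block_maps_fps_def)
    \<comment> \<open>A list with more than \<open>r\<close> descents contributes nothing. The truncation of the subtraction to \<open>0\<close>
      does no harm, because a list has at most \<open>m\<close> descents.\<close>
    also have "\<dots> = (\<Sum>xs | xs \<in> ?P \<and> des xs \<in> {0..r}. real ((m + r - des xs) choose m))"
    proof (rule sum.mono_neutral_right)
      show "\<forall>xs\<in>?P - {xs. xs \<in> ?P \<and> des xs \<in> {0..r}}. real ((m + r - des xs) choose m) = 0"
      proof
        fix xs assume xs: "xs \<in> ?P - {xs. xs \<in> ?P \<and> des xs \<in> {0..r}}"
        then have "des xs > r" by auto
        moreover have "des xs \<le> m"
        proof (cases m)
          case 0
          then show ?thesis using xs by (auto dest!: block_permsD(4))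
        next
          case (Suc m')
          moreover have "blockwise b xs" "length xs = b * m"
            using xs block_permsD[of xs b "{1..b * m}"] by simp_all
          ultimately show ?thesis
            using des_less_blocks[of b xs m'] assms by simp
        qed
        ultimately show "real ((m + r - des xs) choose m) = 0"
          by (simp add: binomial_eq_0)
      qed
    qed auto
    also have "\<dots> = (\<Sum>k\<in>{0..r}. \<Sum>xs | xs \<in> {xs. xs \<in> ?P \<and> des xs \<in> {0..r}} \<and> des xs = k.
                       real ((m + r - des xs) choose m))"
      by (rule sum.group[symmetric]) auto
    also have "\<dots> = (\<Sum>k\<in>{0..r}. real (descent_count b m k) * real ((m + (r - k)) choose m))"
    proof (rule sum.cong)
      fix k assume k: "k \<in> {0..r}"
      then have "{xs. xs \<in> {xs. xs \<in> ?P \<and> des xs \<in> {0..r}} \<and> des xs = k} = {xs \<in> ?P. des xs = k}"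
        by auto
      then show "(\<Sum>xs | xs \<in> {xs. xs \<in> ?P \<and> des xs \<in> {0..r}} \<and> des xs = k.
                   real ((m + r - des xs) choose m)) =
                 real (descent_count b m k) * real ((m + (r - k)) choose m)"
        using k by (simp add: descent_count_def)
    qed simp
    also have "\<dots> = (descent_fps b m * ?B) $ r"
      by (simp add: fps_mult_nth descent_fps_def)
    finally show "block_maps_fps b m $ r = (descent_fps b m * ?B) $ r" .
  qed
  then have "(1 - fps_X) ^ Suc m * block_maps_fps b m =
      descent_fps b m * ((1 - fps_X) ^ Suc m * ?B)"
    by (simp only: mult.left_commute)
  then show ?thesis
    by (simp only: one_minus_X_power_times_binomial_series mult_1_right)
qed

text \<open>
  There are \<open>r ^ n\<close> maps, so passing from \<open>n\<close> to \<open>n + 1\<close> multiplies the coefficient of \<open>X ^ r\<close>, which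
  belongs to \<open>r + 1\<close> values, by \<open>r + 1\<close>.
\<close>

lemma block_maps_fps_1_Suc:
  "block_maps_fps 1 (Suc n) = fps_deriv (fps_X * block_maps_fps 1 n)"
proof -
  have "class_egf 1 = fps_exp 1" by (rule fps_ext) (simp add: class_egf_def)
  then have "block_maps 1 n r = real r ^ n" for n r
    by (simp add: block_maps_def fps_exp_power_mult)
  then show ?thesis by (intro fps_ext) (simp add: block_maps_fps_def algebra_simps)
qed

lemma class_egf_2_deriv2: "fps_deriv (fps_deriv (class_egf 2)) = class_egf 2"
proof (rule fps_ext)
  fix n
  have "(fact (Suc (Suc n)) :: real) = real (Suc (Suc n)) * (real (Suc n) * fact n)"
    by (simp only: fact_Suc of_nat_mult)
  then show "fps_deriv (fps_deriv (class_egf 2)) $ n = class_egf 2 $ n"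
    by (simp add: class_egf_def del: fact_Suc of_nat_Suc)
qed

text \<open>
  This is \<open>sinh\<^sup>2 = cosh\<^sup>2 - 1\<close>: the derivative of \<open>cosh\<^sup>2 - sinh\<^sup>2\<close> vanishes, so this difference is its
  constant term.
\<close>

lemma class_egf_2_pythagoras: "fps_deriv (class_egf 2) ^ 2 = class_egf 2 ^ 2 - 1"
proof -
  let ?c = "class_egf 2"
  have "fps_deriv (?c ^ 2 - fps_deriv ?c ^ 2) = 0"
    by (simp add: power2_eq_square class_egf_2_deriv2)
  then obtain a where "?c ^ 2 - fps_deriv ?c ^ 2 = fps_const a"
    by (metis fps_deriv_eq_0_iff)
  moreover from this have "a = 1"
    by (drule_tac arg_cong[of _ _ "\<lambda>f. f $ 0"]) (simp add: class_egf_def power2_eq_square)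
  ultimately show ?thesis by (simp add: algebra_simps)
qed

text \<open>
  Enlarging the domain by two elements means differentiating \<open>cosh ^ Suc r\<close> twice, and
  \<open>sinh\<^sup>2 = cosh\<^sup>2 - 1\<close> brings the result back to powers of \<open>cosh\<close>.
\<close>

lemma block_maps_2_Suc:
  "block_maps 2 (Suc m) (Suc r) =
    real (Suc r) * (real (Suc r) * block_maps 2 m (Suc r) - real r * block_maps 2 m (r - 1))"
proof -
  let ?c = "class_egf 2"
  have "fps_deriv (fps_deriv (?c ^ Suc r)) =
        fps_const (real (Suc r)) * (fps_const (real (Suc r)) * ?c ^ Suc r - fps_const (real r) * ?c ^ (r - 1))"
  proof (cases r)
    case 0
    then show ?thesis by (simp add: class_egf_2_deriv2)
  next
    case (Suc q)
    have d: "fps_deriv (?c ^ Suc k) = fps_const (real (Suc k)) * (fps_deriv ?c * ?c ^ k)" for k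
      unfolding fps_deriv_power by (simp add: algebra_simps)
    have "fps_deriv (fps_deriv (?c ^ Suc r)) =
        fps_const (real (Suc r)) * (?c * ?c ^ r + fps_deriv ?c * fps_deriv (?c ^ r))"
      unfolding d by (simp add: class_egf_2_deriv2 algebra_simps del: of_nat_Suc)
    also have "\<dots> = fps_const (real (Suc r)) *
        (?c ^ Suc r + fps_const (real r) * fps_deriv ?c ^ 2 * ?c ^ q)"
      unfolding Suc d by (simp add: power2_eq_square algebra_simps del: of_nat_Suc)
    also have "fps_deriv ?c ^ 2 = ?c ^ 2 - 1" by (rule class_egf_2_pythagoras)
    also have "fps_const (real (Suc r)) * (?c ^ Suc r + fps_const (real r) * (?c ^ 2 - 1) * ?c ^ q) =
      fps_const (real (Suc r)) * ((1 + fps_const (real r)) * ?c ^ Suc r - fps_const (real r) * ?c ^ (r - 1))"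
      by (simp add: Suc power2_eq_square algebra_simps)
    also have "1 + fps_const (real r) = fps_const (real (Suc r))"
      by (simp flip: fps_const_add)
    finally show ?thesis .
  qed
  then have "fps_deriv (fps_deriv (?c ^ Suc r)) $ (2 * m) =
    real (Suc r) * (real (Suc r) * (?c ^ Suc r) $ (2 * m) - real r * (?c ^ (r - 1)) $ (2 * m))"
    by (simp del: power_Suc of_nat_Suc)
  then have "real (2 * m + 1) * (real (2 * m + 2) * (?c ^ Suc r) $ (2 * m + 2)) =
    real (Suc r) * (real (Suc r) * (?c ^ Suc r) $ (2 * m) - real r * (?c ^ (r - 1)) $ (2 * m))"
    by (simp del: power_Suc)
  then have "fact (2 * m) * (real (2 * m + 1) * (real (2 * m + 2) * (?c ^ Suc r) $ (2 * m + 2))) =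
    fact (2 * m) * (real (Suc r) * (real (Suc r) * (?c ^ Suc r) $ (2 * m) - real r * (?c ^ (r - 1)) $ (2 * m)))"
    by (rule arg_cong)
  moreover have "fact (2 * Suc m) = fact (2 * m) * real (2 * m + 1) * real (2 * m + 2)"
    by (simp add: algebra_simps)
  ultimately show ?thesis
    by (simp add: block_maps_def algebra_simps del: power_Suc of_nat_Suc fact_Suc)
qed

text \<open>
  Multiplication by \<open>r + 1\<close> and by \<open>r\<close> become \<open>F \<mapsto> (X F)'\<close> and \<open>F \<mapsto> X F'\<close>; the shift of \<open>r\<close> by
  two is multiplication by \<open>X\<^sup>2\<close>. For \<open>m = 0\<close> this would miss the value \<open>block_maps 2 0 0 = 1\<close>. The
  series in the inner parentheses belongs to the arrangements of \<open>2 * m + 1\<close> elements.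
\<close>

lemma block_maps_fps_2_Suc:
  assumes "m > 0"
  shows "block_maps_fps 2 (Suc m) = fps_deriv (fps_X *
    (fps_deriv (fps_X * block_maps_fps 2 m) - fps_X * fps_deriv (fps_X ^ 2 * block_maps_fps 2 m)))"
proof (rule fps_ext)
  fix r
  have 0: "block_maps 2 m 0 = 0" using assms by (simp add: block_maps_def)
  have "real r * block_maps 2 m (r - 1) = (fps_X * fps_deriv (fps_X ^ 2 * block_maps_fps 2 m)) $ r"
  proof (cases r)
    case (Suc q)
    then show ?thesis using 0
      by (cases q) (simp_all add: block_maps_fps_def fps_X_power_mult_nth del: fps_deriv_mult)
  qed simp
  then show "block_maps_fps 2 (Suc m) $ r = fps_deriv (fps_X *
    (fps_deriv (fps_X * block_maps_fps 2 m) - fps_X * fps_deriv (fps_X ^ 2 * block_maps_fps 2 m))) $ r"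
    by (simp add: block_maps_fps_def block_maps_2_Suc del: fps_deriv_mult)
qed

section \<open>Recurrences for the descent numbers\<close>

text \<open>
  This rewrites the derivative of a series in terms of its numerator \<open>P\<close>, so that the differential
  recurrences above become recurrences between numerators, without any division.
\<close>

lemma one_minus_X_power_times_deriv:
  fixes F :: "real fps"
  assumes "P = (1 - fps_X) ^ Suc m * F"
  shows "(1 - fps_X) ^ Suc (Suc m) * fps_deriv F =
    (1 - fps_X) * fps_deriv P + fps_const (real (Suc m)) * P"
proof -
  have "fps_deriv ((1 - fps_X) ^ Suc m) = - (fps_const (real (Suc m)) * (1 - fps_X) ^ m)"
    by (subst fps_deriv_power) (simp del: of_nat_Suc power_Suc flip: fps_const_neg)
  note power_rule = this
  show ?thesis
    unfolding assms fps_deriv_mult power_rule by (simp add: algebra_simps del: of_nat_Suc)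
qed

text \<open>
  Coefficients are indexed by integers and vanish at negative indices. So multiplication by \<open>X\<close> is a
  plain index shift, and recurrences with indices \<open>k - 1\<close> and \<open>k - 2\<close> need no case distinction.
\<close>

definition coeff_int :: "real fps \<Rightarrow> int \<Rightarrow> real" where
  "coeff_int F k = (if k < 0 then 0 else F $ nat k)"

lemma coeff_int_simps [simp]:
  "coeff_int (F + G) k = coeff_int F k + coeff_int G k"
  "coeff_int (F - G) k = coeff_int F k - coeff_int G k"
  "coeff_int (fps_const c * F) k = c * coeff_int F k"
  "coeff_int (fps_X * F) k = coeff_int F (k - 1)"
  by (auto simp: coeff_int_def nat_diff_distrib)

lemma coeff_int_X_deriv: "coeff_int (fps_X * fps_deriv F) k = k * coeff_int F k"
  by (auto simp: coeff_int_def)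

text \<open>
  With \<open>M = n + 1\<close> this is the recurrence of the Eulerian numbers. In the half-ascending case it is
  the second of two steps.
\<close>

lemma coeff_eulerian_step:
  assumes "P = (1 - fps_X) ^ M * F" "Q = (1 - fps_X) ^ Suc M * fps_deriv (fps_X * F)" "M > 0"
  shows "coeff_int Q k =
    of_int (k + 1) * coeff_int P k + of_int (int M - k) * coeff_int P (k - 1)"
proof -
  obtain m where M: "M = Suc m" using assms(3) gr0_implies_Suc by blast
  define D where "D = fps_X * fps_deriv P"
  have D: "coeff_int D k = k * coeff_int P k" for k
    unfolding D_def by (rule coeff_int_X_deriv)
  note d = one_minus_X_power_times_deriv[OF assms(1)[unfolded M]]
  have "Q = (1 - fps_X) * ((1 - fps_X) ^ M * F) + fps_X * ((1 - fps_X) ^ Suc M * fps_deriv F)"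
    unfolding assms(2) by (simp add: algebra_simps)
  also have "\<dots> = (1 - fps_X) * P + fps_X * ((1 - fps_X) * fps_deriv P + fps_const (real M) * P)"
    using d M assms(1) by metis
  also have "\<dots> = P - fps_X * P + D - fps_X * D
      + fps_const (real M) * (fps_X * P)"
    by (simp add: D_def algebra_simps)
  finally have "coeff_int Q k = coeff_int (P - fps_X * P + D
      - fps_X * D + fps_const (real M) * (fps_X * P)) k" by simp
  then show ?thesis unfolding coeff_int_simps D by (simp add: algebra_simps)
qed

text \<open>
  The first of the two steps in the half-ascending case, which leads from \<open>2 * m\<close> to \<open>2 * m + 1\<close>
  elements with \<open>M = m + 1\<close>. Splitting the step from \<open>2 * m\<close> to \<open>2 * m + 2\<close> in this way keeps all
  coefficients nonnegative on the relevant range.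
\<close>

lemma coeff_odd_step:
  assumes "P = (1 - fps_X) ^ M * F" "M > 0"
    "Q = (1 - fps_X) ^ M * (fps_deriv (fps_X * F) - fps_X * fps_deriv (fps_X ^ 2 * F))"
  shows "coeff_int Q k =
    of_int (k + 1) * coeff_int P k + real M * coeff_int P (k - 1) + of_int (int M - k) * coeff_int P (k - 2)"
proof -
  obtain m where M: "M = Suc m" using assms(2) gr0_implies_Suc by blast
  define D where "D = fps_X * fps_deriv P"
  have D: "coeff_int D k = k * coeff_int P k" for k
    unfolding D_def by (rule coeff_int_X_deriv)
  note d = one_minus_X_power_times_deriv[OF assms(1)[unfolded M]]
  have "fps_deriv (fps_X ^ 2 * F) = fps_const 2 * (fps_X * F) + fps_X ^ 2 * fps_deriv F"
    by (simp add: power2_eq_square algebra_simps numeral_fps_const mult_2 flip: fps_const_add)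
  then have "Q = (1 - fps_X) ^ M * F - fps_const 2 * (fps_X * (fps_X * ((1 - fps_X) ^ M * F)))
      + (fps_X + fps_X * fps_X) * ((1 - fps_X) ^ Suc M * fps_deriv F)"
    unfolding assms(3) by (simp add: power2_eq_square algebra_simps)
  also have "\<dots> = P - fps_const 2 * (fps_X * (fps_X * P))
      + (fps_X + fps_X * fps_X) * ((1 - fps_X) * fps_deriv P + fps_const (real M) * P)"
    using d M assms(1) by metis
  also have "\<dots> = P - fps_const 2 * (fps_X * (fps_X * P)) + D
      - fps_X * (fps_X * D)
      + fps_const (real M) * (fps_X * P) + fps_const (real M) * (fps_X * (fps_X * P))"
    by (simp add: D_def algebra_simps)
  finally have "coeff_int Q k = coeff_int (P - fps_const 2 * (fps_X * (fps_X * P)) + D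
      - fps_X * (fps_X * D)
      + fps_const (real M) * (fps_X * P) + fps_const (real M) * (fps_X * (fps_X * P))) k" by simp
  then show ?thesis unfolding coeff_int_simps D by (simp add: algebra_simps)
qed


section \<open>Preservation of log-concavity\<close>

text \<open>
  Support exactly \<open>{0..<N}\<close> is part of the notion because it excludes internal zeros, so that the
  inequality for neighbouring indices implies the one for indices at arbitrary distance.
\<close>

definition log_concave_on :: "nat \<Rightarrow> (int \<Rightarrow> real) \<Rightarrow> bool" where
  "log_concave_on N u \<longleftrightarrow>
    (\<forall>k. 0 \<le> k \<and> k < int N \<longrightarrow> 0 < u k) \<and>
    (\<forall>k. k < 0 \<or> int N \<le> k \<longrightarrow> u k = 0) \<and>
    (\<forall>k. u (k - 1) * u (k + 1) \<le> (u k)\<^sup>2)"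

lemma log_concave_onD:
  assumes "log_concave_on N u"
  shows "0 \<le> k \<Longrightarrow> k < int N \<Longrightarrow> 0 < u k"
    and "k < 0 \<or> int N \<le> k \<Longrightarrow> u k = 0"
    and "u (k - 1) * u (k + 1) \<le> (u k)\<^sup>2"
    and "0 \<le> u k"
  using assms unfolding log_concave_on_def by (blast, blast, blast, metis less_imp_le not_le order_refl)

text \<open>
  The ratios \<open>u (j + 1) / u j\<close> decrease with \<open>j\<close> on the support.
\<close>

lemma log_concave_on_far:
  assumes "log_concave_on N u" "i \<le> j"
  shows "u (i - 1) * u (j + 1) \<le> u i * u j"
  using assms(2)
proof (induction j rule: int_ge_induct)
  case base
  show ?case using log_concave_onD(3)[OF assms(1), of i] by (simp add: power2_eq_square)
next
  case (step j)
  note nonneg = log_concave_onD(4)[OF assms(1)]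
  show ?case
  proof (cases "i - 1 < 0 \<or> int N \<le> j + 1 + 1")
    case True
    then have "u (i - 1) * u (j + 1 + 1) = 0"
      using log_concave_onD(2)[OF assms(1)] by auto
    then show ?thesis by (simp only: mult_nonneg_nonneg nonneg)
  next
    case False
    then have pos: "0 < u j"
      using step.hyps log_concave_onD(1)[OF assms(1), of j] by simp
    have "u (i - 1) * u (j + 1 + 1) * u j = u (i - 1) * (u (j + 1 - 1) * u (j + 1 + 1))"
      by simp
    also have "\<dots> \<le> u (i - 1) * (u (j + 1))\<^sup>2"
      by (intro mult_left_mono nonneg log_concave_onD(3)[OF assms(1)])
    also have "\<dots> = u (i - 1) * u (j + 1) * u (j + 1)"
      by (simp add: power2_eq_square)
    also have "\<dots> \<le> u i * u j * u (j + 1)"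
      by (intro mult_right_mono nonneg step.IH)
    finally have "u (i - 1) * u (j + 1 + 1) * u j \<le> u i * u (j + 1) * u j"
      by (simp add: mult_ac)
    then show ?thesis using pos by simp
  qed
qed

text \<open>
  Expand both sides and bound each product of two entries on the left by log-concavity. What is left
  of the difference is the square \<open>(s - r)\<^sup>2\<close>.
\<close>

lemma two_term_inequality:
  fixes a c q r s t :: real
  assumes "1 \<le> a" "1 \<le> c" "r * t \<le> s\<^sup>2" "q * t \<le> r * s" "q * s \<le> r\<^sup>2"
  shows "((a - 1) * r + (c + 1) * q) * ((a + 1) * t + (c - 1) * s) \<le> (a * s + c * r)\<^sup>2"
proof -
  have "(a\<^sup>2 - 1) * (r * t) \<le> (a\<^sup>2 - 1) * s\<^sup>2"
    using assms by (intro mult_left_mono) simp_all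
  moreover have "(c\<^sup>2 - 1) * (q * s) \<le> (c\<^sup>2 - 1) * r\<^sup>2"
    using assms by (intro mult_left_mono) simp_all
  moreover have "((a + 1) * (c + 1)) * (q * t) \<le> ((a + 1) * (c + 1)) * (r * s)"
    using assms by (intro mult_left_mono) simp_all
  moreover have "0 \<le> (s - r)\<^sup>2" by simp
  ultimately show ?thesis by (simp add: power2_eq_square algebra_simps)
qed

text \<open>
  As before, bounding all products except those in \<open>q * s\<close> and \<open>r\<^sup>2\<close> leaves
  \<open>(s - q)\<^sup>2 + (b\<^sup>2 - (a - 1) * (c - 1)) * (r\<^sup>2 - q * s)\<close>, and both summands are nonnegative.
\<close>

lemma three_term_inequality:
  fixes a b c p q r s t :: real
  assumes "1 \<le> a" "1 \<le> c" "0 \<le> b" "(a - 1) * (c - 1) \<le> b\<^sup>2"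
    and "r * t \<le> s\<^sup>2" "q * t \<le> r * s" "q * s \<le> r\<^sup>2" "p * t \<le> q * s" "p * s \<le> q * r" "p * r \<le> q\<^sup>2"
  shows "((a - 1) * r + b * q + (c + 1) * p) * ((a + 1) * t + b * s + (c - 1) * r)
    \<le> (a * s + b * r + c * q)\<^sup>2"
proof -
  have "(a\<^sup>2 - 1) * (r * t) \<le> (a\<^sup>2 - 1) * s\<^sup>2"
    using assms by (intro mult_left_mono) simp_all
  moreover have "(c\<^sup>2 - 1) * (p * r) \<le> (c\<^sup>2 - 1) * q\<^sup>2"
    using assms by (intro mult_left_mono) simp_all
  moreover have "((a + 1) * b) * (q * t) \<le> ((a + 1) * b) * (r * s)"
    using assms by (intro mult_left_mono) simp_all
  moreover have "((c + 1) * b) * (p * s) \<le> ((c + 1) * b) * (q * r)"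
    using assms by (intro mult_left_mono) simp_all
  moreover have "((a + 1) * (c + 1)) * (p * t) \<le> ((a + 1) * (c + 1)) * (q * s)"
    using assms by (intro mult_left_mono) simp_all
  moreover have "(b\<^sup>2 - (a - 1) * (c - 1)) * (q * s) \<le> (b\<^sup>2 - (a - 1) * (c - 1)) * r\<^sup>2"
    using assms by (intro mult_left_mono) simp_all
  moreover have "0 \<le> (s - q)\<^sup>2" by simp
  ultimately show ?thesis by (simp add: power2_eq_square algebra_simps)
qed

text \<open>
  The two possible values of \<open>M\<close> are those for which \<open>v\<close> has support exactly \<open>{0..<M}\<close>: the entries
  of \<open>u\<close> reach at most the index \<open>k = N\<close> of \<open>v\<close>, and if \<open>M = N\<close>, then the factor \<open>M - k\<close> vanishes there.
  Both occur: \<open>M = N + 1\<close> for \<open>A\<close>, and \<open>M = N\<close> in the second step for \<open>U\<close>.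
\<close>

lemma log_concave_on_two_term:
  assumes u: "log_concave_on N u" and "0 < N" and "N = M \<or> Suc N = M"
    and v: "\<And>k. v k = of_int (k + 1) * u k + of_int (int M - k) * u (k - 1)"
  shows "log_concave_on M v"
  unfolding log_concave_on_def
proof (intro conjI allI impI)
  note nonneg = log_concave_onD(4)[OF u]
  show zero: "v k = 0" if "k < 0 \<or> int M \<le> k" for k
  proof -
    have "u k = 0" "k \<noteq> int M \<Longrightarrow> u (k - 1) = 0"
      using that assms(3) by (auto intro!: log_concave_onD(2)[OF u])
    then show ?thesis by (cases "k = int M") (simp_all add: v)
  qed
  show "0 < v k" if k: "0 \<le> k \<and> k < int M" for k
  proof (cases "k < int N")
    case True
    then have "0 < of_int (k + 1) * u k" using k log_concave_onD(1)[OF u, of k] by simp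
    moreover have "0 \<le> of_int (int M - k) * u (k - 1)" using k nonneg by simp
    ultimately show ?thesis by (simp add: v)
  next
    case False
    then have "0 < u (k - 1)" using k assms(2,3) by (intro log_concave_onD(1)[OF u]) auto
    then have "0 < of_int (int M - k) * u (k - 1)" using k by simp
    moreover have "0 \<le> of_int (k + 1) * u k" using k nonneg by simp
    ultimately show ?thesis by (simp add: v)
  qed
  show "v (k - 1) * v (k + 1) \<le> (v k)\<^sup>2" for k
  proof (cases "k - 1 < 0 \<or> int M \<le> k + 1")
    case True
    then have "v (k - 1) * v (k + 1) = 0" using zero by auto
    then show ?thesis by (simp only: zero_le_power2)
  next
    case False
    then have ac: "1 \<le> real_of_int (k + 1)" "1 \<le> real_of_int (int M - k)" by linarith+
    have "u (k - 1) * u (k + 1) \<le> (u k)\<^sup>2" "u (k - 2) * u (k + 1) \<le> u (k - 1) * u k"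
      "u (k - 2) * u k \<le> (u (k - 1))\<^sup>2"
      using log_concave_on_far[OF u, of k k] log_concave_on_far[OF u, of "k - 1" k]
        log_concave_on_far[OF u, of "k - 1" "k - 1"] by (simp_all add: power2_eq_square)
    from two_term_inequality[OF ac this] show ?thesis
      by (simp add: v algebra_simps)
  qed
qed

lemma log_concave_on_three_term:
  assumes u: "log_concave_on N u" and "0 < N" and M: "M = Suc N"
    and v: "\<And>k. v k = of_int (k + 1) * u k + real M * u (k - 1) + of_int (int M - k) * u (k - 2)"
  shows "log_concave_on M v"
  unfolding log_concave_on_def
proof (intro conjI allI impI)
  note nonneg = log_concave_onD(4)[OF u]
  show zero: "v k = 0" if "k < 0 \<or> int M \<le> k" for k
  proof -
    have "u k = 0" "u (k - 1) = 0" "k \<noteq> int M \<Longrightarrow> u (k - 2) = 0"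
      using that M by (auto intro!: log_concave_onD(2)[OF u])
    then show ?thesis by (cases "k = int M") (simp_all add: v)
  qed
  show "0 < v k" if k: "0 \<le> k \<and> k < int M" for k
  proof -
    have "0 \<le> of_int (k + 1) * u k" "0 \<le> real M * u (k - 1)" "0 \<le> of_int (int M - k) * u (k - 2)"
      using k nonneg by simp_all
    moreover have "0 < of_int (k + 1) * u k \<or> 0 < real M * u (k - 1)"
    proof (cases "k < int N")
      case True
      then show ?thesis using k log_concave_onD(1)[OF u, of k] by simp
    next
      case False
      then show ?thesis using k assms(2) M log_concave_onD(1)[OF u, of "k - 1"] by simp
    qed
    ultimately show ?thesis unfolding v by linarith
  qed
  show "v (k - 1) * v (k + 1) \<le> (v k)\<^sup>2" for k
  proof (cases "k - 1 < 0 \<or> int M \<le> k + 1")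
    case True
    then have "v (k - 1) * v (k + 1) = 0" using zero by auto
    then show ?thesis by (simp only: zero_le_power2)
  next
    case False
    then have ac: "1 \<le> real_of_int (k + 1)" "1 \<le> real_of_int (int M - k)" by linarith+
    have b: "0 \<le> real M" "(real_of_int (k + 1) - 1) * (real_of_int (int M - k) - 1) \<le> (real M)\<^sup>2"
    proof -
      have "(real_of_int (k + 1) - 1) * (real_of_int (int M - k) - 1) \<le> real M * real M"
        using False by (intro mult_mono) linarith+
      then show "(real_of_int (k + 1) - 1) * (real_of_int (int M - k) - 1) \<le> (real M)\<^sup>2"
        by (simp add: power2_eq_square)
    qed simp
    have "u (k - 1) * u (k + 1) \<le> (u k)\<^sup>2" "u (k - 2) * u (k + 1) \<le> u (k - 1) * u k"
      "u (k - 2) * u k \<le> (u (k - 1))\<^sup>2" "u (k - 3) * u (k + 1) \<le> u (k - 2) * u k"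
      "u (k - 3) * u k \<le> u (k - 2) * u (k - 1)" "u (k - 3) * u (k - 1) \<le> (u (k - 2))\<^sup>2"
      using log_concave_on_far[OF u, of k k] log_concave_on_far[OF u, of "k - 1" k]
        log_concave_on_far[OF u, of "k - 1" "k - 1"] log_concave_on_far[OF u, of "k - 2" k]
        log_concave_on_far[OF u, of "k - 2" "k - 1"] log_concave_on_far[OF u, of "k - 2" "k - 2"]
      by (simp_all add: power2_eq_square)
    from three_term_inequality[OF ac b this] show ?thesis
      by (simp add: v algebra_simps)
  qed
qed

section \<open>Log-concavity of the descent numbers\<close>

text \<open>
  The base case of both inductions. The hypothesis says that the series is \<open>1 / (1 - X)\<^sup>2\<close>.
\<close>

lemma descent_fps_single_block:
  assumes "block_maps_fps b 1 = fps_deriv (fps_X * Abs_fps (\<lambda>_. 1))" "b > 0"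
  shows "descent_fps b 1 = 1"
proof -
  have "block_maps_fps b 1 = Abs_fps (\<lambda>j. real ((1 + j) choose 1))"
    unfolding assms(1) by (rule fps_ext) simp
  then show ?thesis
    using descent_fps_eq[OF assms(2), of 1] one_minus_X_power_times_binomial_series[of 1] by simp
qed

lemma log_concave_on_one: "log_concave_on 1 (coeff_int 1)"
  by (auto simp: log_concave_on_def coeff_int_def)

lemma eulerian_log_concave: "0 < n \<Longrightarrow> log_concave_on n (coeff_int (descent_fps 1 n))"
proof (induction n rule: nat_induct_non_zero)
  case 1
  have "block_maps_fps 1 0 = Abs_fps (\<lambda>_. 1)"
    by (rule fps_ext) (simp add: block_maps_fps_def block_maps_def class_egf_def fps_power_zeroth)
  then have "descent_fps 1 1 = 1"
    using block_maps_fps_1_Suc[of 0] by (intro descent_fps_single_block) simp_all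
  then show ?case using log_concave_on_one by simp
next
  case (Suc n)
  have "coeff_int (descent_fps 1 (Suc n)) k =
      of_int (k + 1) * coeff_int (descent_fps 1 n) k + of_int (int (Suc n) - k) * coeff_int (descent_fps 1 n) (k - 1)" for k :: int
    by (rule coeff_eulerian_step[OF descent_fps_eq])
      (simp_all only: descent_fps_eq block_maps_fps_1_Suc zero_less_one zero_less_Suc)
  then show ?case using log_concave_on_two_term[OF Suc.IH Suc.hyps] by blast
qed

lemma half_ascending_log_concave: "0 < m \<Longrightarrow> log_concave_on m (coeff_int (descent_fps 2 m))"
proof (induction m rule: nat_induct_non_zero)
  case 1
  have "block_maps 2 1 (Suc r) = real (Suc r)" for r
    using block_maps_2_Suc[of 0 r] by (simp add: block_maps_def class_egf_def fps_power_zeroth algebra_simps)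
  then have "block_maps_fps 2 1 = fps_deriv (fps_X * Abs_fps (\<lambda>_. 1))"
    by (intro fps_ext) (simp add: block_maps_fps_def)
  then have "descent_fps 2 1 = 1" by (intro descent_fps_single_block) simp_all
  then show ?case using log_concave_on_one by simp
next
  case (Suc m)
  let ?G = "block_maps_fps 2 m"
  let ?S = "fps_deriv (fps_X * ?G) - fps_X * fps_deriv (fps_X ^ 2 * ?G)"
  \<comment> \<open>\<open>?T\<close> counts arrangements of \<open>2 * m + 1\<close> elements by descents: \<open>m\<close> ascending pairs, then a single
    entry.\<close>
  let ?T = "(1 - fps_X) ^ Suc m * ?S"
  have "coeff_int ?T k = of_int (k + 1) * coeff_int (descent_fps 2 m) k
      + real (Suc m) * coeff_int (descent_fps 2 m) (k - 1)
      + of_int (int (Suc m) - k) * coeff_int (descent_fps 2 m) (k - 2)" for k :: int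
    by (rule coeff_odd_step[OF descent_fps_eq]) simp_all
  then have T: "log_concave_on (Suc m) (coeff_int ?T)"
    using log_concave_on_three_term[OF Suc.IH Suc.hyps refl] by blast
  have "coeff_int (descent_fps 2 (Suc m)) k =
      of_int (k + 1) * coeff_int ?T k + of_int (int (Suc m) - k) * coeff_int ?T (k - 1)" for k :: int
    by (rule coeff_eulerian_step[OF refl])
      (simp_all only: descent_fps_eq block_maps_fps_2_Suc[OF Suc.hyps] zero_less_numeral zero_less_Suc)
  then show ?case using log_concave_on_two_term[OF T] by blast
qed

section \<open>Permutations in one-line notation\<close>

lemma des_eq_card: "des xs = card {i. Suc i < length xs \<and> xs ! i > xs ! Suc i}"
proof (induction xs rule: des.induct)
  case (3 x y xs)
  let ?D = "\<lambda>xs. {i. Suc i < length xs \<and> xs ! i > xs ! Suc i}"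
  have fin: "finite (?D zs)" for zs :: "nat list"
    by (rule finite_subset[of _ "{..<length zs}"]) auto
  have "?D (x # y # xs) = (if x > y then {0} else {}) \<union> Suc ` ?D (y # xs)" (is "?L = ?R")
  proof (rule set_eqI)
    fix i show "i \<in> ?L \<longleftrightarrow> i \<in> ?R" by (cases i) auto
  qed
  then have "card (?D (x # y # xs)) = card (if x > y then {0::nat} else {}) + card (Suc ` ?D (y # xs))"
    using fin[of "y # xs"] by (simp only:) (subst card_Un_disjoint, auto)
  also have "card (Suc ` ?D (y # xs)) = des (y # xs)"
    using 3 by (simp add: card_image)
  finally show ?case by simp
qed auto

text \<open>
  Injectivity holds since permutations fix everything outside \<open>{1..n}\<close>; then surjectivity follows by
  comparing cardinalities.
\<close>

lemma bij_betw_one_line: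
  "bij_betw (\<lambda>p. map p [1..<Suc n]) {p. p permutes {1..n}} (permutations_of_set {1..n})"
proof -
  let ?f = "\<lambda>p. map p [1..<Suc n]" and ?P = "{p. p permutes {1..n}}"
  have inj: "inj_on ?f ?P"
  proof (rule inj_onI)
    fix p q assume pq: "p \<in> ?P" "q \<in> ?P" "?f p = ?f q"
    show "p = q"
    proof
      fix i show "p i = q i"
      proof (cases "i \<in> {1..n}")
        case True
        then show ?thesis using pq(3) by (simp add: map_eq_conv del: upt_Suc)
      next
        case False
        then show ?thesis using pq(1,2) by (simp add: permutes_def)
      qed
    qed
  qed
  have "?f ` ?P \<subseteq> permutations_of_set {1..n}"
  proof
    fix xs assume "xs \<in> ?f ` ?P"
    then obtain p where p: "p permutes {1..n}" "xs = ?f p" by auto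
    have "set xs = {1..n}"
      using permutes_image[OF p(1)] p(2)
      by (simp add: atLeastLessThanSuc_atLeastAtMost del: upt_Suc)
    moreover have "distinct xs"
      using p by (simp add: distinct_map permutes_inj_on)
    ultimately show "xs \<in> permutations_of_set {1..n}" by auto
  qed
  moreover have "card (?f ` ?P) = card (permutations_of_set {1..n})"
    using inj by (simp add: card_image card_permutations)
  ultimately have "?f ` ?P = permutations_of_set {1..n}"
    by (intro card_subset_eq) auto
  then show ?thesis using inj by (simp add: bij_betw_def)
qed

lemma des_one_line: "des (map p [1..<Suc n]) = card (descents n p)"
proof -
  have "descents n p = Suc ` {i. Suc i < n \<and> p (Suc i) > p (Suc (Suc i))}" (is "?L = ?R")
  proof (rule set_eqI)
    fix i show "i \<in> ?L \<longleftrightarrow> i \<in> ?R" by (cases i) (auto simp: descents_def)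
  qed
  moreover have "{i. Suc i < n \<and> p (Suc i) > p (Suc (Suc i))} =
      {i. Suc i < length (map p [1..<Suc n]) \<and> map p [1..<Suc n] ! i > map p [1..<Suc n] ! Suc i}"
    by (auto simp del: upt_Suc)
  ultimately show ?thesis by (simp only: des_eq_card card_image[OF inj_Suc])
qed

lemma descent_count_eq_card:
  "descent_count b m k =
    card {p. p permutes {1..b * m} \<and> blockwise b (map p [1..<Suc (b * m)]) \<and> card (descents (b * m) p) = k}"
    (is "_ = card ?P")
proof -
  let ?f = "\<lambda>p. map p [1..<Suc (b * m)]"
  have "bij_betw ?f ?P {xs \<in> permutations_of_set {1..b * m}. blockwise b xs \<and> des xs = k}"
  proof -
    note bij = bij_betw_one_line[of "b * m"]
    have "?f ` ?P = {xs \<in> permutations_of_set {1..b * m}. blockwise b xs \<and> des xs = k}"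
      unfolding bij_betw_imp_surj_on[OF bij, symmetric] by (auto simp: des_one_line simp del: upt_Suc One_nat_def)
    moreover have "inj_on ?f ?P"
      using bij_betw_imp_inj_on[OF bij] by (rule inj_on_subset) auto
    ultimately show ?thesis by (simp add: bij_betw_def)
  qed
  then show ?thesis
    by (simp add: descent_count_def block_perms_def bij_betw_same_card conj_assoc)
qed

lemma A_eq_descent_count: "A n k = descent_count 1 n k"
  using descent_count_eq_card[of 1 n k] by (simp add: A_def blockwise_def)

text \<open>
  Position \<open>i\<close> of the list carries the entry \<open>p (Suc i)\<close>, so the pair inside the block number \<open>j\<close>
  starts at the even position \<open>2 * j - 2\<close>. Inside a block \<open>\<le>\<close> and \<open><\<close> agree by injectivity.
\<close>

lemma blockwise_2_one_line:
  assumes "p permutes {1..2 * m}"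
  shows "blockwise 2 (map p [1..<Suc (2 * m)]) \<longleftrightarrow> half_ascending (2 * m) p"
proof -
  have eq: "map p [1..<Suc (2 * m)] ! i = p (Suc i)" if "i < 2 * m" for i
    using that by (simp del: upt_Suc)
  have "blockwise 2 (map p [1..<Suc (2 * m)]) \<longleftrightarrow>
      (\<forall>i. Suc i < 2 * m \<longrightarrow> even i \<longrightarrow> p (Suc i) \<le> p (Suc (Suc i)))"
    unfolding blockwise_def using eq by (auto simp del: upt_Suc)
  also have "\<dots> \<longleftrightarrow> (\<forall>i. 1 \<le> i \<and> i \<le> m \<longrightarrow> p (2 * i - 1) < p (2 * i))"
  proof (intro iffI allI impI)
    fix i assume *: "\<forall>i. Suc i < 2 * m \<longrightarrow> even i \<longrightarrow> p (Suc i) \<le> p (Suc (Suc i))"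
      and i: "1 \<le> i \<and> i \<le> m"
    then have "p (Suc (2 * i - 2)) \<le> p (Suc (Suc (2 * i - 2)))" by (intro *[rule_format]) auto
    moreover have "Suc (2 * i - 2) = 2 * i - 1" "Suc (Suc (2 * i - 2)) = 2 * i" using i by auto
    moreover have "p (2 * i - 1) \<noteq> p (2 * i)"
    proof -
      have "2 * i - 1 \<noteq> 2 * i" using i by presburger
      then show ?thesis using inj_eq[OF permutes_inj[OF assms]] by blast
    qed
    ultimately show "p (2 * i - 1) < p (2 * i)" by simp
  next
    fix i assume *: "\<forall>i. 1 \<le> i \<and> i \<le> m \<longrightarrow> p (2 * i - 1) < p (2 * i)"
      and i: "Suc i < 2 * m" "even i"
    then obtain j where "i = 2 * j" by (auto elim: evenE)
    then show "p (Suc i) \<le> p (Suc (Suc i))" using *[rule_format, of "Suc j"] i by simp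
  qed
  finally show ?thesis using assms by (simp add: half_ascending_def)
qed

lemma U_eq_descent_count: "U (2 * m) k = descent_count 2 m k"
  unfolding descent_count_eq_card U_def
  by (rule arg_cong[where f = card]) (use blockwise_2_one_line half_ascending_def in blast)

lemma descent_count_log_concave:
  assumes "log_concave_on N (coeff_int (descent_fps b m))" "k \<ge> 1"
  shows "descent_count b m (k - 1) * descent_count b m (k + 1) \<le> (descent_count b m k)\<^sup>2"
proof -
  have eq: "coeff_int (descent_fps b m) (int j) = real (descent_count b m j)" for j
    by (simp add: coeff_int_def descent_fps_def)
  have "int k - 1 = int (k - 1)" "int k + 1 = int (k + 1)" using assms(2) by auto
  then have "real (descent_count b m (k - 1)) * real (descent_count b m (k + 1)) \<le> (real (descent_count b m k))\<^sup>2"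
    using log_concave_onD(3)[OF assms(1), of "int k"] by (simp only: eq)
  then show ?thesis
    by (metis of_nat_le_iff of_nat_mult of_nat_power)
qed

theorem theorem4p1:
  fixes n k :: nat
  assumes "n \<ge> 1" and "k \<ge> 1" and "k \<le> n"
  shows "A n (k - 1) * A n (k + 1) \<le> (A n k)\<^sup>2
    \<and> (even n \<longrightarrow> U n (k - 1) * U n (k + 1) \<le> (U n k)\<^sup>2)"
proof (intro conjI impI)
  show "A n (k - 1) * A n (k + 1) \<le> (A n k)\<^sup>2"
    unfolding A_eq_descent_count
    using assms by (intro descent_count_log_concave[OF eulerian_log_concave]) auto
next
  assume "even n"
  then obtain m where "n = 2 * m" by (elim evenE)
  moreover have "0 < m" using \<open>n = 2 * m\<close> assms(1) by simp
  ultimately show "U n (k - 1) * U n (k + 1) \<le> (U n k)\<^sup>2"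
    using descent_count_log_concave[OF half_ascending_log_concave assms(2)]
    by (simp only: U_eq_descent_count)
qed

end
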